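(* Let $G=(N,A,\mathbf c)$ be a general directed graph (possibly containing directed cycles) with source $s$ and destination $f$, let $\mathcal L$ be the list of auxiliary distributional constraints, and let $j,\ell\in\{1,\dots,2^{|\mathcal L|}\}$ with $j\ne\ell$. Let $\mathbf y_j,\mathbf y_\ell$ be the incidence vectors of the user's $s$–$f$ paths $P_j$ and $P_\ell$ under the response vectors $\mathbf r_j$ and $\mathbf r_\ell$. Let $\mathbf t_j\in\mathbb R^{|N|}$ be auxiliary variables such that $$t_{j,s}=0,\qquad 0\le t_{j,i}\le |N|-1\quad\forall i\in N,\qquad t_{j,a_1}-t_{j,a_2}\le -1+|N|(1-y_{j,a})\quad\forall a=(a_1,a_2)\in A,$$ and suppose that for each node $i\in N\setminus N_{j,\ell}$ and each $a\in FS_i$ $$|y_{j,a}-y_{\ell,a}|\le\sum_{n\in N_{j,\ell}}\min\Big\{\max\{t_{j,i}-t_{j,n};0\}+2-\sum_{a'\in FS_n}y_{j,a'}-\sum_{a'\in FS_i}y_{j,a'}\ ;\ \sum_{a'\in FS_n}y_{j,a'}\Big\}.$$ Then these constraints ensure non-anticipativity for the pair $(j,\ell)$: $P_j$ and $P_\ell$ coincide until a node of $N_{j,\ell}$ is reached.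
   Context: **Graph.** $G=(N,A,\mathbf c)$ is a weighted connected directed graph with finite node set $N$, directed arc set $A$ and random nonnegative cost vector $\mathbf c=(c_a)_{a\in A}$; $s\neq f$ are fixed source and destination nodes. An arc $a\in A$ is written $a=(a_1,a_2)$ with tail $a_1$ and head $a_2$. $FS_i$ is the set of arcs directed out of node $i$. **Paths.** The user's decisions are incidence vectors in $\{0,1\}^{|A|}$ of $s$–$f$ paths in which each node is visited at most once. **Auxiliary constraints and responses.** $\mathcal L$ is a finite list of distributional constraints. Each is associated with a node $i\in N\setminus\{f\}$ and involves only arcs in $FS_i$. It has one of the following two forms, where $\mathbb Q$ is the distribution of $\mathbf c$ and $\mathbb Q_a$ its marginal: - $\mathbb Q_a\{c_a\in[\widetilde l_a,\widetilde u_a]\}\le\widetilde q_a$ for some $a\in FS_i$; - $\mathbb E_{\mathbb Q}\{\sum_{a\in FS_i}p_ac_a\}\le p_0$. The attacker answers each constraint by "satisfied" (1) or "not satisfied" (0). Let $\mathbf r_1,\dots,\mathbf r_{2^{|\mathcal L|}}$ enumerate all vectors of $\{0,1\}^{|\mathcal L|}$, where $r_{jm}$ is the response to the $m$-th constraint in scenario $j$. The user selects one path $\mathbf y_j$ for each scenario $j$. The user learns the responses to the constraints associated with node $i$ only upon reaching node $i$. **Distinguishing nodes.** $N_{j,\ell}\subseteq N\setminus\{f\}$ is the set of nodes $i$ for which some constraint in $\mathcal L$ associated with $i$, say the $m$-th, satisfies $r_{jm}\ne r_{\ell m}$. **Non-anticipativity.** The paths must coincide as long as the user cannot distinguish scenario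 $j$ from scenario $\ell$. Precisely, the pair $(\mathbf y_j,\mathbf y_\ell)$ is non-anticipative if the following holds. If $P_j$ contains no node of $N_{j,\ell}$, then $P_j=P_\ell$. Otherwise, if $n$ is the first node of $P_j$ lying in $N_{j,\ell}$, then $P_\ell$ also contains $n$, and the initial segments of $P_j$ and $P_\ell$ from $s$ up to $n$ are identical (the arcs chosen at $n$ may differ). *)

theory Defs
  imports
    "HOL-Probability.Probability"
    "Graph_Theory.Pair_Digraph"
    "Graph_Theory.Digraph_Component"
begin

text \<open>
  Connectedness is that of the underlying undirected graph. Directed cycles and loops are allowed.
\<close>

locale random_cost_network = pair_fin_digraph G + prob_space M
  for G :: "'a pair_pre_digraph" and M :: "'w measure" +
  fixes c :: "'a \<times> 'a \<Rightarrow> 'w \<Rightarrow> real" and s f :: 'a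
  assumes connected: "Digraph_Component.connected (with_proj G)"
    and cost_measurable: "\<And>a. a \<in> parcs G \<Longrightarrow> c a \<in> borel_measurable M"
    and cost_nonneg: "AE \<omega> in M. \<forall>a\<in>parcs G. 0 \<le> c a \<omega>"
    and source: "s \<in> pverts G"
    and destination: "f \<in> pverts G"
    and source_neq_destination: "s \<noteq> f"

definition cost_distribution ::
    "'a pair_pre_digraph \<Rightarrow> 'w measure \<Rightarrow> ('a \<times> 'a \<Rightarrow> 'w \<Rightarrow> real) \<Rightarrow> ('a \<times> 'a \<Rightarrow> real) measure" where
  "cost_distribution G M c =
     distr M (Pi\<^sub>M (parcs G) (\<lambda>_. borel)) (\<lambda>\<omega>. \<lambda>a\<in>parcs G. c a \<omega>)"

abbreviation forward_star :: "'a pair_pre_digraph \<Rightarrow> 'a \<Rightarrow> ('a \<times> 'a) set" where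
  "forward_star G i \<equiv> out_arcs (with_proj G) i"

text \<open>The first argument of either constructor is the node the constraint is associated with.\<close>

datatype 'a dist_constraint =
    Interval_Prob (assoc_node: 'a) "'a \<times> 'a" real real real
  | Linear_Mean (assoc_node: 'a) "'a \<times> 'a \<Rightarrow> real" real

fun admissible_constraint :: "'a pair_pre_digraph \<Rightarrow> 'a \<Rightarrow> 'a dist_constraint \<Rightarrow> bool" where
  "admissible_constraint G f (Interval_Prob i a l u q) \<longleftrightarrow>
     i \<in> pverts G - {f} \<and> a \<in> forward_star G i"
| "admissible_constraint G f (Linear_Mean i p p0) \<longleftrightarrow> i \<in> pverts G - {f}"

text \<open>
  The meaning of a constraint under the cost distribution. The scenarios below enumerate all
  response vectors, whether or not they are the true answers for a given distribution.
\<close>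

fun constraint_holds ::
    "'a pair_pre_digraph \<Rightarrow> ('a \<times> 'a \<Rightarrow> real) measure \<Rightarrow> 'a dist_constraint \<Rightarrow> bool" where
  "constraint_holds G Q (Interval_Prob i a l u q) \<longleftrightarrow>
     measure (distr Q borel (\<lambda>x. x a)) {l..u} \<le> q"
| "constraint_holds G Q (Linear_Mean i p p0) \<longleftrightarrow>
     integrable Q (\<lambda>x. \<Sum>a\<in>forward_star G i. p a * x a) \<and>
     integral\<^sup>L Q (\<lambda>x. \<Sum>a\<in>forward_star G i. p a * x a) \<le> p0"

definition response_vectors :: "'a dist_constraint list \<Rightarrow> nat list set" where
  "response_vectors L = {v. set v \<subseteq> {0, 1} \<and> length v = length L}"

abbreviation scenarios :: "'a dist_constraint list \<Rightarrow> nat set" where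
  "scenarios L \<equiv> {1..2 ^ length L}"

definition distinguishing_nodes ::
    "'a pair_pre_digraph \<Rightarrow> 'a \<Rightarrow> 'a dist_constraint list \<Rightarrow> nat list \<Rightarrow> nat list \<Rightarrow> 'a set" where
  "distinguishing_nodes G f L v w =
     {i \<in> pverts G - {f}. \<exists>m<length L. assoc_node (L ! m) = i \<and> v ! m \<noteq> w ! m}"

definition incidence_vector ::
    "'a pair_pre_digraph \<Rightarrow> ('a \<times> 'a) list \<Rightarrow> ('a \<times> 'a \<Rightarrow> real) \<Rightarrow> bool" where
  "incidence_vector G p y \<longleftrightarrow> (\<forall>a\<in>parcs G. y a = (if a \<in> set p then 1 else 0))"

text \<open>The arcs of a simple path preceding its visit to \<open>n\<close>.\<close>

definition initial_segment :: "('a \<times> 'a) list \<Rightarrow> 'a \<Rightarrow> ('a \<times> 'a) list" where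
  "initial_segment p n = takeWhile (\<lambda>a. fst a \<noteq> n) p"

text \<open>
  Paths from \<open>s\<close> are given by their arc lists, and \<open>find\<close> returns the first node of \<open>p\<close> in \<open>D\<close>.
\<close>

definition non_anticipative ::
    "'a \<Rightarrow> 'a set \<Rightarrow> ('a \<times> 'a) list \<Rightarrow> ('a \<times> 'a) list \<Rightarrow> bool" where
  "non_anticipative s D p p' \<longleftrightarrow>
     (case find (\<lambda>v. v \<in> D) (pawalk_verts s p) of
        None \<Rightarrow> p = p'
      | Some n \<Rightarrow> n \<in> set (pawalk_verts s p') \<and> initial_segment p n = initial_segment p' n)"

end

theory Submission
  imports Defs
begin

text \<open>
  On the arcs of \<open>P j\<close> the potential \<open>t\<close> grows by at least one, so a node \<open>i\<close> that \<open>P j\<close> leaves before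
  meeting \<open>D\<close> has a smaller potential than every node of \<open>D\<close> that \<open>P j\<close> leaves. Hence every summand
  on the right-hand side vanishes at \<open>i\<close>: the first argument of the minimum is \<open>0 + 2 - 1 - 1\<close> if \<open>P j\<close>
  leaves \<open>n\<close>, and the second is \<open>0\<close> otherwise. So \<open>P l\<close> uses every arc of \<open>P j\<close> before \<open>D\<close>. As a
  simple path has at most one arc leaving each node, the two paths agree up to \<open>D\<close>.
\<close>

lemma potential_le_pcas:
  fixes t :: "'a \<Rightarrow> real"
  assumes "pcas u p v" "\<And>e. e \<in> set p \<Longrightarrow> t (fst e) < t (snd e)" "b \<in> set p"
  shows "t u \<le> t (fst b)"
  using assms
proof (induction p arbitrary: u)
  case (Cons e p)
  show ?case
  proof (cases "b = e")
    case False
    then have "t (snd e) \<le> t (fst b)"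
      using Cons by auto
    moreover have "t u < t (snd e)"
      using Cons.prems(1) Cons.prems(2)[of e] by auto
    ultimately show ?thesis
      by simp
  qed (use Cons.prems(1) in auto)
qed simp

text \<open>An arc failing \<open>Q\<close> lies beyond the prefix, so the head of \<open>a\<close>
  has potential at most that of the tail of \<open>b\<close>; the arc \<open>a\<close> itself makes
  the inequality strict.\<close>

lemma potential_less_takeWhile:
  fixes t :: "'a \<Rightarrow> real"
  assumes "pcas u p v" "\<And>e. e \<in> set p \<Longrightarrow> t (fst e) < t (snd e)"
    and "a \<in> set (takeWhile Q p)" "b \<in> set p" "\<not> Q b"
  shows "t (fst a) < t (fst b)"
  using assms
proof (induction p arbitrary: u)
  case (Cons e p)
  then have Q: "Q e" and b: "b \<in> set p"
    by (auto split: if_splits)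
  show ?case
  proof (cases "a = e")
    case True
    have "t (snd e) \<le> t (fst b)"
      using Cons.prems b by (intro potential_le_pcas[of _ p v]) auto
    then show ?thesis
      using True Cons.prems(2)[of e] by auto
  next
    case False
    then show ?thesis
      using Cons.IH[of "snd e"] Cons.prems Q b by auto
  qed
qed simp

text \<open>One inclusion suffices: while \<open>u\<close> is outside \<open>D\<close>, the first
  arc of \<open>p\<close> lies in \<open>q\<close>, and the only arc of the simple path
  \<open>q\<close> leaving \<open>u\<close> is its first. Strip both and repeat.\<close>

lemma (in pair_wf_digraph) non_anticipativeI:
  assumes "apath u p v" "apath u q v"
    and "set (takeWhile (\<lambda>a. fst a \<notin> D) p) \<subseteq> set q"
  shows "non_anticipative u D p q"
  using assms
proof (induction p arbitrary: u q)
  case Nil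
  \<comment> \<open>Here \<open>u = v\<close>, and a simple path from a node to itself has no
    arcs.\<close>
  then have "q = []"
    using apath_nonempty_ends by (auto simp: apath_Nil_iff)
  then show ?case
    by (simp add: non_anticipative_def)
next
  case (Cons a p)
  have a: "fst a = u" "apath (snd a) p v" "u \<notin> set (pawalk_verts (snd a) p)"
    using Cons.prems(1) by (auto simp: apath_Cons_iff)
  have "u \<noteq> v"
    using apath_nonempty_ends Cons.prems(1) by blast
  then obtain b q' where q: "q = b # q'"
    using Cons.prems(2) by (cases q) (auto simp: apath_Nil_iff)
  have b: "fst b = u" "apath (snd b) q' v" "u \<notin> set (pawalk_verts (snd b) q')"
    using Cons.prems(2) q by (auto simp: apath_Cons_iff)
  show ?case
  proof (cases "u \<in> D")
    case True
    then show ?thesis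
      using a b q by (simp add: non_anticipative_def initial_segment_def)
  next
    case False
    have tails: "fst e \<noteq> u" if "e \<in> set p" for e
      using a that awalk_verts_arc1[of e p] by auto
    have tails': "fst e \<noteq> u" if "e \<in> set q'" for e
      using b that awalk_verts_arc1[of e q'] by auto
    have "a = b"
      using Cons.prems(3) False a q tails'[of a] by auto
    moreover have "set (takeWhile (\<lambda>a. fst a \<notin> D) p) \<subseteq> set q'"
    proof
      fix e
      assume e: "e \<in> set (takeWhile (\<lambda>a. fst a \<notin> D) p)"
      \<comment> \<open>\<open>b\<close> leaves \<open>u\<close>, which the simple path
        \<open>p\<close> never revisits, so removing \<open>b\<close> from \<open>q\<close> loses no
        arc of the prefix.\<close>
      then have "e \<noteq> b"
        using tails[of e] b by (auto dest: set_takeWhileD)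
      then show "e \<in> set q'"
        using e Cons.prems(3) False a q by auto
    qed
    ultimately have "non_anticipative (snd a) D p q'"
      using Cons.IH a b by simp
    \<comment> \<open>As \<open>u\<close> is outside \<open>D\<close>, the first node in
      \<open>D\<close> is that of the remaining path and differs from \<open>u\<close>; both initial
      segments just gain the common arc \<open>a\<close>.\<close>
    then show ?thesis
      using False a b q \<open>a = b\<close>
      by (auto simp: non_anticipative_def initial_segment_def split: option.splits
            dest: find_Some_iff[THEN iffD1])
  qed
qed

theorem proposition2:
  fixes G :: "'a pair_pre_digraph"
    and M :: "'w measure"
    and c :: "'a \<times> 'a \<Rightarrow> 'w \<Rightarrow> real"
    and s f :: 'a
    and L :: "'a dist_constraint list"
    and r :: "nat \<Rightarrow> nat list"
    and P :: "nat \<Rightarrow> ('a \<times> 'a) list"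
    and y :: "nat \<Rightarrow> 'a \<times> 'a \<Rightarrow> real"
    and t :: "'a \<Rightarrow> real"
    and j l :: nat
  defines "N \<equiv> pverts G"
    and "A \<equiv> parcs G"
    and "FS \<equiv> forward_star G"
    and "D \<equiv> distinguishing_nodes G f L (r j) (r l)"
  assumes "random_cost_network G M c s f"
    and "\<forall>C\<in>set L. admissible_constraint G f C"
    and "bij_betw r (scenarios L) (response_vectors L)"
    and "\<forall>k\<in>scenarios L. pre_digraph.apath (with_proj G) s (P k) f \<and> incidence_vector G (P k) (y k)"
    and "j \<in> scenarios L" and "l \<in> scenarios L" and "j \<noteq> l"
    and "t s = 0"
    and "\<forall>i\<in>N. 0 \<le> t i \<and> t i \<le> real (card N) - 1"
    and "\<forall>a\<in>A. t (fst a) - t (snd a) \<le> -1 + real (card N) * (1 - y j a)"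
    and "\<forall>i\<in>N - D. \<forall>a\<in>FS i.
           \<bar>y j a - y l a\<bar> \<le>
             (\<Sum>n\<in>D. min (max (t i - t n) 0 + 2 - (\<Sum>a'\<in>FS n. y j a') - (\<Sum>a'\<in>FS i. y j a'))
                          (\<Sum>a'\<in>FS n. y j a'))"
  shows "non_anticipative s D (P j) (P l)"
proof -
  interpret random_cost_network G M c s f
    by fact
  have path: "apath s (P k) f" and y: "incidence_vector G (P k) (y k)" if "k \<in> {j, l}" for k
    using assms(8-10) that by auto
  have arcs: "set (P k) \<subseteq> parcs G" and cas: "pcas s (P k) f" if "k \<in> {j, l}" for k
    using path[OF that] by (auto simp: apath_def awalk_def)
  have t_less: "t (fst e) < t (snd e)" if "e \<in> set (P j)" for e
  proof -
    have "e \<in> parcs G" "y j e = 1"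
      using that arcs[of j] y[of j] by (auto simp: incidence_vector_def)
    \<comment> \<open>With \<open>y j e = 1\<close> the big-M term vanishes, leaving a difference of
      at most -1.\<close>
    then show ?thesis
      using assms(14) unfolding A_def by fastforce
  qed
  have y_nonneg: "0 \<le> y j e" if "e \<in> FS n" for e n
    using that y[of j] by (auto simp: incidence_vector_def FS_def)
  \<comment> \<open>A lower bound suffices, since both sums are subtracted in the first argument of
    the minimum.\<close>
  have sum_ge_1: "1 \<le> (\<Sum>a'\<in>FS (fst e). y j a')" if "e \<in> set (P j)" for e
  proof -
    have "e \<in> FS (fst e)" "y j e = 1"
      using that arcs[of j] y[of j] by (auto simp: incidence_vector_def FS_def)
    moreover have "finite (FS (fst e))"
      using finite_out_arcs by (simp add: FS_def)
    ultimately show ?thesis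
      using member_le_sum[of e "FS (fst e)" "y j"] y_nonneg by auto
  qed
  have "a \<in> set (P l)" if a: "a \<in> set (takeWhile (\<lambda>a. fst a \<notin> D) (P j))" for a
  proof -
    have aP: "a \<in> set (P j)" and aD: "fst a \<notin> D"
      using a by (auto dest: set_takeWhileD)
    have aG: "a \<in> parcs G"
      using aP arcs[of j] by auto
    have "min (max (t (fst a) - t n) 0 + 2 - (\<Sum>a'\<in>FS n. y j a') - (\<Sum>a'\<in>FS (fst a). y j a'))
            (\<Sum>a'\<in>FS n. y j a') \<le> 0" if n: "n \<in> D" for n
    proof (cases "\<exists>b\<in>set (P j). fst b = n")
      case True
      then obtain b where b: "b \<in> set (P j)" "fst b = n"
        by blast
      then have "t (fst a) < t n"
        using potential_less_takeWhile[OF cas[of j] t_less a b(1)] n by auto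
      then show ?thesis
        using sum_ge_1[OF aP] sum_ge_1[OF b(1)] b(2) by auto
    next
      case False
      then have "(\<Sum>a'\<in>FS n. y j a') = 0"
        using y[of j] by (intro sum.neutral) (auto simp: incidence_vector_def FS_def)
      then show ?thesis
        by simp
    qed
    moreover have "fst a \<in> N - D" "a \<in> FS (fst a)"
      using aD aG arc_fst_in_verts by (auto simp: N_def FS_def)
    ultimately have "\<bar>y j a - y l a\<bar> \<le> 0"
      using assms(15) by (meson order_trans sum_nonpos)
    \<comment> \<open>Now \<open>y l a = y j a = 1\<close>, which for an incidence vector means that
      \<open>P l\<close> uses \<open>a\<close>.\<close>
    then show ?thesis
      using aP aG y[of j] y[of l] by (auto simp: incidence_vector_def split: if_splits)
  qed
  then show ?thesis
    using path by (intro non_anticipativeI) auto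
qed

end
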